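(* Let $\alpha \in \mathbb{R}_{>0}$ and let $\mathbb{N}_0[\alpha] = \{f(\alpha) : f(X) \in \mathbb{N}_0[X]\}$, viewed as an additive submonoid of $\mathbb{R}$. The following are equivalent: (a) $\mathbb{N}_0[\alpha]$ is an FFM; (b) $\mathbb{N}_0[\alpha]$ is a BFM; (c) $\mathbb{N}_0[\alpha]$ satisfies the ACCP.
   Context: Monoids are commutative, cancellative, additively written; $\mathbb{N}_0[\alpha]$ is reduced. An atom of $M$ is a nonzero element $a$ such that $a=x+y$ implies $x=0$ or $y=0$; $M$ is atomic if generated by its atoms. For atomic $M$, a factorization of $x$ is a formal sum (element of the free commutative monoid on the atoms) of atoms summing to $x$, its length being its number of atoms counted with multiplicity; $\mathsf{Z}(x)$ is the set of factorizations of $x$ and $\mathsf{L}(x)$ the set of their lengths. $M$ is an FFM (finite factorization monoid) if it is atomic and $|\mathsf{Z}(x)|<\infty$ for all $x$; a BFM (bounded factorization monoid) if it is atomic and $|\mathsf{L}(x)|<\infty$ for all $x$. A principal ideal is a set $x+M$; $M$ satisfies the ACCP if every ascending chain of principal ideals eventually stabilizes. *)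

theory Defs
  imports Complex_Main "HOL-Library.Multiset" "HOL-Computational_Algebra.Polynomial"
begin

text \<open>
  A monoid is represented by its carrier: a subset \<open>M\<close> of a type of class
  \<open>cancel_comm_monoid_add\<close> (so commutative and cancellative) that satisfies
  \<open>add_submonoid\<close>. The definitions of atoms, atomicity and factorizations below are
  those for reduced monoids, i.e. monoids whose only invertible element is \<open>0\<close>.
\<close>

definition add_submonoid :: "'a::cancel_comm_monoid_add set \<Rightarrow> bool" where
  "add_submonoid M \<longleftrightarrow> 0 \<in> M \<and> (\<forall>x\<in>M. \<forall>y\<in>M. x + y \<in> M)"

definition atoms :: "'a::cancel_comm_monoid_add set \<Rightarrow> 'a set" where
  "atoms M = {a \<in> M. a \<noteq> 0 \<and> (\<forall>x\<in>M. \<forall>y\<in>M. a = x + y \<longrightarrow> x = 0 \<or> y = 0)}"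

definition atomic :: "'a::cancel_comm_monoid_add set \<Rightarrow> bool" where
  "atomic M \<longleftrightarrow> add_submonoid hull (atoms M) = M"

text \<open>Finite multisets of atoms are the elements of the free commutative monoid on the atoms.\<close>

definition factorizations :: "'a::cancel_comm_monoid_add set \<Rightarrow> 'a \<Rightarrow> 'a multiset set" where
  "factorizations M x = {F. set_mset F \<subseteq> atoms M \<and> \<Sum>\<^sub># F = x}"

definition factorization_lengths :: "'a::cancel_comm_monoid_add set \<Rightarrow> 'a \<Rightarrow> nat set" where
  "factorization_lengths M x = size ` factorizations M x"

definition FFM :: "'a::cancel_comm_monoid_add set \<Rightarrow> bool" where
  "FFM M \<longleftrightarrow> atomic M \<and> (\<forall>x\<in>M. finite (factorizations M x))"

definition BFM :: "'a::cancel_comm_monoid_add set \<Rightarrow> bool" where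
  "BFM M \<longleftrightarrow> atomic M \<and> (\<forall>x\<in>M. finite (factorization_lengths M x))"

definition principal_ideal :: "'a::cancel_comm_monoid_add set \<Rightarrow> 'a set \<Rightarrow> bool" where
  "principal_ideal M I \<longleftrightarrow> (\<exists>x\<in>M. I = (+) x ` M)"

definition ACCP :: "'a::cancel_comm_monoid_add set \<Rightarrow> bool" where
  "ACCP M \<longleftrightarrow> (\<forall>I :: nat \<Rightarrow> 'a set.
     (\<forall>n. principal_ideal M (I n)) \<and> (\<forall>n. I n \<subseteq> I (Suc n)) \<longrightarrow>
     (\<exists>N. \<forall>n\<ge>N. I n = I N))"

definition nat_poly_values :: "real \<Rightarrow> real set" where
  "nat_poly_values \<alpha> = {poly (map_poly real f) \<alpha> | f :: nat poly. True}"

lemma add_submonoid_nat_poly_values: "add_submonoid (nat_poly_values \<alpha>)"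
proof -
  have "map_poly real (f + g) = map_poly real f + map_poly real g" for f g :: "nat poly"
    by (rule poly_eqI) (simp add: coeff_map_poly)
  hence "poly (map_poly real f) \<alpha> + poly (map_poly real g) \<alpha> = poly (map_poly real (f + g)) \<alpha>"
    for f g :: "nat poly"
    by simp
  moreover have "poly (map_poly real 0) \<alpha> = 0"
    by simp
  ultimately show ?thesis
    unfolding add_submonoid_def nat_poly_values_def by (smt (verit) mem_Collect_eq)
qed

lemma nat_poly_values_reduced:
  assumes "\<alpha> > 0" "x \<in> nat_poly_values \<alpha>" "y \<in> nat_poly_values \<alpha>" "x + y = 0"
  shows "x = 0 \<and> y = 0"
proof -
  have "z \<ge> 0" if "z \<in> nat_poly_values \<alpha>" for z
    using that assms(1) unfolding nat_poly_values_def
    by (auto simp: poly_altdef coeff_map_poly intro!: sum_nonneg)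
  with assms show ?thesis
    by (smt (verit))
qed

end

theory Submission
  imports Defs "HOL-Computational_Algebra.Fundamental_Theorem_Algebra"
begin

text \<open>
  The implications from FFM to BFM to ACCP hold in every monoid: along a strictly ascending chain
  of principal ideals the maximal factorization length strictly decreases.

  For the converse, the case \<open>\<alpha> \<ge> 1\<close> is a counting argument, so let \<open>\<alpha> < 1\<close>. All atoms are powers
  of \<open>\<alpha>\<close>, so it suffices that every element has only finitely many representations \<open>f(\<alpha>)\<close> with
  \<open>f \<in> \<nat>[X]\<close>. Otherwise the ACCP yields an element \<open>w\<close>, minimal for divisibility, with infinitely
  many representations; by minimality each \<open>X^i\<close> occurs in only finitely many of them, so \<open>w\<close> has
  representations of arbitrarily high order at \<open>0\<close>. Comparing one of these with a fixed
  representation \<open>b\<close>, a positivity theorem for real polynomials shows that \<open>t - t \<alpha>^k\<close> lies in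
  \<open>\<nat>[\<alpha>]\<close> for some \<open>k > 0\<close> and \<open>t = 2 (1 + \<alpha>)^N w\<close>. The elements \<open>t \<alpha>^(k i)\<close> then generate
  a strictly ascending chain of principal ideals.
\<close>

subsection \<open>Real polynomials that are positive on the positive reals\<close>

definition nonneg_coeffs :: "real poly \<Rightarrow> bool" where
  "nonneg_coeffs p \<longleftrightarrow> (\<forall>i. 0 \<le> coeff p i)"

lemma nonneg_coeffs_mult:
  "nonneg_coeffs p \<Longrightarrow> nonneg_coeffs q \<Longrightarrow> nonneg_coeffs (p * q)"
  by (simp add: nonneg_coeffs_def coeff_mult sum_nonneg)

section \<open>Quadratic factors without real roots\<close>

lemma eventually_ge_quadratic:
  fixes e w :: real
  assumes "e > 0"
  obtains K where "\<And>t. t \<ge> K \<Longrightarrow> e * t\<^sup>2 - t \<ge> w"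
proof
  fix t assume t: "t \<ge> max 1 ((1 + \<bar>w\<bar>) / e)"
  hence "e * t \<ge> 1 + \<bar>w\<bar>" "t \<ge> 1"
    using assms by (auto simp: field_simps)
  hence "\<bar>w\<bar> * 1 \<le> (e * t - 1) * t"
    by (intro mult_mono) auto
  thus "e * t\<^sup>2 - t \<ge> w" by (simp add: power2_eq_square algebra_simps)
qed

lemma quadratic_ge_min:
  fixes e t :: real
  assumes "e > 0"
  shows "e * t\<^sup>2 - t \<ge> - (1 / (4 * e))"
proof -
  have "e * t\<^sup>2 - t + 1 / (4 * e) = e * (t - 1 / (2 * e))\<^sup>2"
    using assms by (simp add: power2_eq_square field_simps)
  thus ?thesis using assms by (smt (verit) zero_le_mult_iff zero_le_power2)
qed

text \<open>The form \<open>y^2 - 2uyz + vz^2\<close> is positive definite because u^2 < v, so it is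
  at least e(y^2 + vz^2) for some e > 0. The problem then separates into one quadratic in y and one
  in z, at least one of which has a large argument.\<close>

lemma definite_form_dominates_linear:
  fixes u v :: real
  assumes "u\<^sup>2 < v"
  obtains K where "\<And>y z. y + z \<ge> K \<Longrightarrow> y\<^sup>2 - 2 * u * y * z + v * z\<^sup>2 - y - v * z \<ge> 0"
proof -
  have v: "v > 0" using assms by (smt (verit) zero_le_power2)
  define e where "e = (v - u\<^sup>2) / (2 * v)"
  have e: "e > 0" using v assms by (simp add: e_def)
  obtain K1 where K1: "\<And>t. t \<ge> K1 \<Longrightarrow> e * t\<^sup>2 - t \<ge> v / (4 * e)"
    using eventually_ge_quadratic[OF e, of "v / (4 * e)"] by blast
  obtain K2 where K2: "\<And>t. t \<ge> K2 \<Longrightarrow> e * t\<^sup>2 - t \<ge> 1 / (4 * e * v)"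
    using eventually_ge_quadratic[OF e, of "1 / (4 * e * v)"] by blast
  show ?thesis
  proof
    fix y z :: real
    assume yz: "y + z \<ge> K1 + K2"
    have "y\<^sup>2 - 2 * u * y * z + v * z\<^sup>2 - e * (v * z\<^sup>2 + y\<^sup>2)
        = ((y - u * z)\<^sup>2 + v * (z - u * y / v)\<^sup>2) / 2"
      using v by (simp add: e_def power2_eq_square field_simps)
    moreover have "\<dots> \<ge> 0" using v by simp
    ultimately have form: "y\<^sup>2 - 2 * u * y * z + v * z\<^sup>2 \<ge> e * (v * z\<^sup>2 + y\<^sup>2)" by linarith
    \<comment> \<open>If z is large, its term outweighs the minimum -1/(4e) of the y-term. Otherwise
      y is large and its term outweighs v times that minimum.\<close>
    have "(e * y\<^sup>2 - y) + v * (e * z\<^sup>2 - z) \<ge> 0"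
    proof (cases "z \<ge> K2")
      case True
      hence "v * (e * z\<^sup>2 - z) \<ge> v * (1 / (4 * e * v))"
        using K2 v by (intro mult_left_mono) auto
      hence "v * (e * z\<^sup>2 - z) \<ge> 1 / (4 * e)" using v by simp
      thus ?thesis using quadratic_ge_min[OF e, of y] by linarith
    next
      case False
      hence "e * y\<^sup>2 - y \<ge> v / (4 * e)" using K1 yz by simp
      moreover have "v * (e * z\<^sup>2 - z) \<ge> v * (- (1 / (4 * e)))"
        using quadratic_ge_min[OF e, of z] v by (intro mult_left_mono) auto
      ultimately show ?thesis by simp
    qed
    thus "y\<^sup>2 - 2 * u * y * z + v * z\<^sup>2 - y - v * z \<ge> 0"
      using form by (simp add: algebra_simps)
  qed
qed

text \<open>The coefficient of X^(j+2) is \<open>C j - 2 * u * C (j+1) + v * C (j+2)\<close>.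
  Multiplied by (j+1)(j+2), it becomes \<open>C j\<close> times the definite form minus its linear
  part, at y = j + 2 and z = N - j. Here y + z = N + 2, so one large N serves all j.\<close>

lemma nonneg_coeffs_quadratic:
  fixes u v :: real
  assumes "u\<^sup>2 < v"
  shows "\<exists>N. nonneg_coeffs ([:1, 1:] ^ N * [:v, -2 * u, 1:])"
proof -
  obtain K where K: "\<And>y z. y + z \<ge> K \<Longrightarrow> y\<^sup>2 - 2 * u * y * z + v * z\<^sup>2 - y - v * z \<ge> 0"
    using definite_form_dominates_linear[OF assms] by blast
  have v: "v > 0" using assms by (smt (verit) zero_le_power2)
  \<comment> \<open>The bound K serves the degrees from 2 on; 2u/v serves the coefficient of X,
    which is vN - 2u.\<close>
  obtain N :: nat where N: "real N \<ge> max K (2 * u / v)"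
    using real_arch_simple by blast
  define C where "C i = real (N choose i)" for i
  have C: "coeff ([:1, 1:] ^ N) i = C i" for i
    by (cases "i \<le> N") (auto simp: coeff_linear_poly_power C_def coeff_eq_0 degree_linear_power)
  have c: "coeff ([:1, 1:] ^ N * [:v, -2 * u, 1:]) i \<ge> 0" for i
  proof -
    consider "i = 0" | "i = 1" | j where "i = Suc (Suc j)" "j > N" | j where "i = Suc (Suc j)" "j \<le> N"
      by (metis One_nat_def not_less old.nat.exhaust)
    thus ?thesis
    proof cases
      case 1
      thus ?thesis using v by (simp add: C_def coeff_linear_poly_power)
    next
      case 2
      have "v * real N \<ge> 2 * u" using N v by (simp add: field_simps)
      thus ?thesis using 2 by (simp add: C coeff_pCons C_def)
    next
      case 3
      thus ?thesis by (simp add: C C_def binomial_eq_0)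
    next
      case (4 j)
      define y z where "y = real j + 2" and "z = real N - real j"
      have "(N - j) * (N choose j) = Suc j * (N choose Suc j)"
        by (simp only: binomial_absorb_comp binomial_absorption)
      hence "real (N - j) * C j = real (Suc j) * C (Suc j)"
        unfolding C_def by (metis of_nat_mult)
      hence 1: "(y - 1) * C (Suc j) = z * C j"
        using 4 by (simp add: y_def z_def of_nat_diff algebra_simps)
      have "(N - Suc j) * (N choose Suc j) = Suc (Suc j) * (N choose Suc (Suc j))"
        by (simp only: binomial_absorb_comp binomial_absorption)
      hence "real (N - Suc j) * C (Suc j) = real (Suc (Suc j)) * C (Suc (Suc j))"
        unfolding C_def by (metis of_nat_mult)
      \<comment> \<open>For j = N the natural subtraction gives 0 and not z - 1 = -1, but then
        \<open>C (Suc j)\<close> is 0.\<close>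
      moreover have "real (N - Suc j) * C (Suc j) = (z - 1) * C (Suc j)"
        using 4 by (cases "j = N") (auto simp: C_def z_def of_nat_diff)
      ultimately have 2: "y * C (Suc (Suc j)) = (z - 1) * C (Suc j)"
        by (simp add: y_def algebra_simps)
      have "(y - 1) * y * (C j - 2 * u * C (Suc j) + v * C (Suc (Suc j)))
          = (y - 1) * y * C j - 2 * u * y * ((y - 1) * C (Suc j))
            + v * (y - 1) * (y * C (Suc (Suc j)))"
        by (simp add: algebra_simps)
      also have "\<dots> = (y - 1) * y * C j - 2 * u * y * (z * C j) + v * (z - 1) * (z * C j)"
        unfolding 2 1[symmetric] by (simp add: algebra_simps)
      also have "\<dots> = (y\<^sup>2 - 2 * u * y * z + v * z\<^sup>2 - y - v * z) * C j"
        by (simp add: algebra_simps power2_eq_square)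
      also have "\<dots> \<ge> 0"
        using N by (intro mult_nonneg_nonneg K) (auto simp: y_def z_def C_def)
      finally have "C j - 2 * u * C (Suc j) + v * C (Suc (Suc j)) \<ge> 0"
        by (rule mult_left_le_imp_le[of "(y - 1) * y" 0, simplified]) (simp add: y_def)
      thus ?thesis using 4 by (simp add: C)
    qed
  qed
  show ?thesis unfolding nonneg_coeffs_def using c by blast
qed

section \<open>Factors of real polynomials obtained from complex roots\<close>

lemma map_poly_of_real_mult:
  "map_poly complex_of_real (p * q) = map_poly complex_of_real p * map_poly complex_of_real q"
  by (rule poly_eqI) (simp add: coeff_map_poly coeff_mult)

lemma map_poly_of_real_add:
  "map_poly complex_of_real (p + q) = map_poly complex_of_real p + map_poly complex_of_real q"
  by (rule poly_eqI) (simp add: coeff_map_poly)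

lemma poly_map_poly_of_real:
  "poly (map_poly complex_of_real p) (of_real x) = of_real (poly p x)"
  by (induction p) (simp_all add: map_poly_pCons)

text \<open>A complex root z is either real, giving a linear factor, or a root of the real
  polynomial \<open>s\<close> with roots z and its conjugate. Then u = Re z and v = |z|^2.\<close>

lemma real_poly_linear_or_quadratic_factor:
  fixes q :: "real poly"
  assumes "degree q > 0"
  obtains a where "[:- a, 1:] dvd q"
  | u v where "u\<^sup>2 < v" "[:v, - 2 * u, 1:] dvd q"
proof -
  let ?C = "map_poly complex_of_real"
  have "degree (?C q) > 0" using assms by (simp add: degree_map_poly)
  hence "\<not> constant (poly (?C q))" by (simp add: constant_degree)
  then obtain z where z: "poly (?C q) z = 0"
    using fundamental_theorem_of_algebra by blast
  show thesis
  proof (cases "Im z = 0")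
    case True
    hence "z = of_real (Re z)" by (simp add: complex_eq_iff)
    hence "poly (?C q) (of_real (Re z)) = 0" using z by simp
    hence "poly q (Re z) = 0" by (simp add: poly_map_poly_of_real)
    thus thesis using that(1) by (simp add: poly_eq_0_iff_dvd)
  next
    case False
    define s where "s = [:(cmod z)\<^sup>2, - 2 * Re z, 1:]"
    have "poly (?C s) z = 0"
      unfolding s_def cmod_power2
      by (simp add: map_poly_pCons complex_eq_iff power2_eq_square algebra_simps)
    moreover have "?C q = ?C s * ?C (q div s) + ?C (q mod s)"
      by (simp add: map_poly_of_real_mult[symmetric] map_poly_of_real_add[symmetric])
    ultimately have mod: "poly (?C (q mod s)) z = 0" using z by simp
    have "s \<noteq> 0" "degree s = 2" by (simp_all add: s_def)
    hence "degree (q mod s) < 2"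
      using degree_mod_less[of s q] by auto
    then obtain c d where cd: "q mod s = [:c, d:]"
      by (metis One_nat_def degree_0 degree_pCons_eq_if less_2_cases_iff pCons_cases pCons_0_0 not_less_eq
           degree_eq_zeroE Suc_1 less_Suc0)
    \<comment> \<open>The remainder c + dX vanishes at the nonreal z; the imaginary part gives d =
      0, then the real part gives c = 0.\<close>
    hence "Re z * d + c = 0" "Im z * d = 0"
      using mod by (auto simp: map_poly_pCons complex_eq_iff)
    hence "q mod s = 0" using False cd by simp
    hence "s dvd q" by (simp add: dvd_eq_mod_eq_0)
    moreover have "(Re z)\<^sup>2 < (cmod z)\<^sup>2" using False by (simp add: cmod_power2)
    ultimately show thesis using that(2) unfolding s_def by blast
  qed
qed

text \<open>The univariate case of a theorem of Poincare and Polya.\<close>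
lemma positive_poly_nonneg_coeffs_multiple:
  fixes q :: "real poly"
  assumes "\<And>x. x > 0 \<Longrightarrow> poly q x > 0"
  shows "\<exists>N. nonneg_coeffs ([:1, 1:] ^ N * q)"
  using assms
proof (induction "degree q" arbitrary: q rule: less_induct)
  case less
  \<comment> \<open>Splitting off a positive factor \<open>s\<close> leaves a positive cofactor of
    smaller degree. The powers of 1 + X that work for the two factors multiply to one that works for
    \<open>q\<close>.\<close>
  have step: "\<exists>N. nonneg_coeffs ([:1, 1:] ^ N * q)"
    if dvd: "s dvd q" and deg: "degree s > 0" and pos: "\<And>x. x > 0 \<Longrightarrow> poly s x > 0"
      and ex: "\<exists>N. nonneg_coeffs ([:1, 1:] ^ N * s)" for s
  proof -
    obtain t where t: "q = s * t" using dvd by blast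
    have tpos: "poly t x > 0" if "x > 0" for x
      using less.prems[OF that] pos[OF that] by (simp add: t zero_less_mult_iff)
    have "t \<noteq> 0" using tpos[of 1] by auto
    moreover have "s \<noteq> 0" using deg by auto
    ultimately have "degree t < degree q" using deg by (simp add: t degree_mult_eq)
    then obtain N where "nonneg_coeffs ([:1, 1:] ^ N * t)"
      using less.hyps tpos by blast
    moreover obtain K where "nonneg_coeffs ([:1, 1:] ^ K * s)" using ex by blast
    ultimately have "nonneg_coeffs (([:1, 1:] ^ K * s) * ([:1, 1:] ^ N * t))"
      by (rule nonneg_coeffs_mult[rotated])
    hence "nonneg_coeffs ([:1, 1:] ^ (K + N) * q)" by (simp add: t power_add mult_ac)
    thus ?thesis by blast
  qed
  show ?case
  proof (cases "degree q > 0")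
    case False
    then obtain a where "q = [:a:]" by (auto elim: degree_eq_zeroE)
    moreover have "a > 0" using less.prems[of 1] calculation by simp
    ultimately have "nonneg_coeffs ([:1, 1:] ^ 0 * q)" by (simp add: nonneg_coeffs_def coeff_pCons split: nat.split)
    thus ?thesis by blast
  next
    case True
    thus ?thesis
    proof (cases rule: real_poly_linear_or_quadratic_factor)
      case (1 a)
      hence "poly q a = 0" by (simp add: poly_eq_0_iff_dvd)
      \<comment> \<open>A positive root would contradict positivity, so X - a needs no
        multiplier.\<close>
      hence "a \<le> 0" using less.prems[of a] by force
      hence "nonneg_coeffs ([:1, 1:] ^ 0 * [:- a, 1:])"
        by (simp add: nonneg_coeffs_def coeff_pCons split: nat.split)
      hence "\<exists>N. nonneg_coeffs ([:1, 1:] ^ N * [:- a, 1:])" by blast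
      thus ?thesis using 1 \<open>a \<le> 0\<close> by (intro step[of "[:- a, 1:]"]) auto
    next
      case (2 u v)
      have "poly [:v, - 2 * u, 1:] x > 0" for x
      proof -
        have "poly [:v, - 2 * u, 1:] x = (x - u)\<^sup>2 + (v - u\<^sup>2)"
          by (simp add: power2_eq_square algebra_simps)
        also have "\<dots> > 0" using 2 by (smt (verit) zero_le_power2)
        finally show ?thesis .
      qed
      thus ?thesis
        using 2 nonneg_coeffs_quadratic by (intro step[of "[:v, - 2 * u, 1:]"]) auto
    qed
  qed
qed

subsection \<open>Chain conditions in reduced monoids\<close>

definition reduced :: "'a::cancel_comm_monoid_add set \<Rightarrow> bool" where
  "reduced M \<longleftrightarrow> (\<forall>x\<in>M. \<forall>y\<in>M. x + y = 0 \<longrightarrow> x = 0 \<and> y = 0)"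

text \<open>Without a minimal element, dependent choice gives a sequence of proper divisors whose
  principal ideals ascend. Where they stabilize, consecutive terms divide each other, and
  reducedness makes their difference 0.\<close>

lemma ACCP_minimal:
  assumes "add_submonoid M" "reduced M" "ACCP M" "S \<subseteq> M" "S \<noteq> {}"
  shows "\<exists>x\<in>S. \<forall>y\<in>S. \<forall>z\<in>M. x = y + z \<longrightarrow> z = 0"
proof (rule ccontr)
  assume "\<not> ?thesis"
  hence step: "\<exists>y\<in>S. \<exists>z\<in>M. x = y + z \<and> z \<noteq> 0" if "x \<in> S" for x
    using that by blast
  obtain x0 where "x0 \<in> S" using assms by blast
  then obtain x where x: "\<And>n. x n \<in> S" "\<And>n. \<exists>z\<in>M. x n = x (Suc n) + z \<and> z \<noteq> 0"
    using dependent_nat_choice[where P = "\<lambda>_ x. x \<in> S"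
        and Q = "\<lambda>_ x y. \<exists>z\<in>M. x = y + z \<and> z \<noteq> 0"] step by metis
  define I where "I n = (+) (x n) ` M" for n
  have "I n \<subseteq> I (Suc n)" for n
  proof -
    obtain z where "z \<in> M" "x n = x (Suc n) + z" using x by blast
    thus ?thesis using assms(1) by (auto simp: I_def add_submonoid_def add.assoc)
  qed
  moreover have "principal_ideal M (I n)" for n
    using x assms unfolding principal_ideal_def I_def by blast
  ultimately obtain N where N: "\<forall>n\<ge>N. I n = I N"
    using assms(3) unfolding ACCP_def by blast
  have "x (Suc N) \<in> I (Suc N)"
    using assms(1) unfolding I_def add_submonoid_def by force
  moreover have "I (Suc N) = I N" by (rule N[rule_format]) simp
  ultimately have "x (Suc N) \<in> I N" by simp
  then obtain m where m: "m \<in> M" "x (Suc N) = x N + m" by (auto simp: I_def)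
  obtain z where z: "z \<in> M" "x N = x (Suc N) + z" "z \<noteq> 0" using x by blast
  have "x (Suc N) = x (Suc N) + (z + m)" by (subst m(2), subst z(2)) (rule add.assoc)
  hence "z + m = 0" by (simp only: add_cancel_right_right)
  thus False using z m assms(2) unfolding reduced_def by blast
qed

lemma factorizations_add:
  assumes "F \<in> factorizations M x" "G \<in> factorizations M y"
  shows "F + G \<in> factorizations M (x + y)"
  using assms by (auto simp: factorizations_def)

lemma factorization_exists:
  assumes "atomic M" "x \<in> M"
  shows "factorizations M x \<noteq> {}"
proof -
  have "x \<in> add_submonoid hull (atoms M)" using assms by (simp add: atomic_def)
  thus ?thesis
  proof (rule hull_induct)
    fix a assume "a \<in> atoms M"
    hence "{#a#} \<in> factorizations M a" by (simp add: factorizations_def)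
    thus "factorizations M a \<noteq> {}" by blast
  next
    have "{#} \<in> factorizations M 0" by (simp add: factorizations_def)
    moreover have "factorizations M (x + y) \<noteq> {}"
      if "factorizations M x \<noteq> {}" "factorizations M y \<noteq> {}" for x y
      using that factorizations_add[of _ M x _ y] by blast
    ultimately show "add_submonoid {x. factorizations M x \<noteq> {}}"
      unfolding add_submonoid_def by blast
  qed
qed

lemma add_submonoid_zero: "add_submonoid M \<Longrightarrow> 0 \<in> M"
  by (simp add: add_submonoid_def)

lemma add_submonoid_add: "add_submonoid M \<Longrightarrow> x \<in> M \<Longrightarrow> y \<in> M \<Longrightarrow> x + y \<in> M"
  by (simp add: add_submonoid_def)

lemma atomicI:
  assumes "add_submonoid M" "\<And>x. x \<in> M \<Longrightarrow> factorizations M x \<noteq> {}"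
  shows "atomic M"
proof -
  have "add_submonoid hull (atoms M) \<subseteq> M"
    using assms(1) by (intro hull_minimal) (auto simp: atoms_def)
  moreover have "x \<in> add_submonoid hull (atoms M)" if "x \<in> M" for x
  proof -
    have H: "add_submonoid (add_submonoid hull (atoms M))"
      by (rule hull_in) (unfold add_submonoid_def, blast)
    have "\<Sum>\<^sub># F \<in> add_submonoid hull (atoms M)" if "set_mset F \<subseteq> atoms M" for F
      using that
    proof (induction F)
      case empty
      have "0 \<in> add_submonoid hull (atoms M)" by (rule add_submonoid_zero[OF H])
      thus ?case by simp
    next
      case (add a F)
      hence "a \<in> add_submonoid hull (atoms M)" by (simp add: hull_inc)
      hence "a + \<Sum>\<^sub># F \<in> add_submonoid hull (atoms M)"
        using add by (intro add_submonoid_add[OF H]) simp_all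
      thus ?case by simp
    qed
    thus ?thesis using assms(2)[OF \<open>x \<in> M\<close>] by (auto simp: factorizations_def)
  qed
  ultimately show ?thesis unfolding atomic_def by blast
qed

text \<open>A minimal element without factorization is neither 0 nor an atom. It therefore splits
  into two nonzero summands, which have factorizations by minimality.\<close>

lemma ACCP_imp_atomic:
  assumes "add_submonoid M" "reduced M" "ACCP M"
  shows "atomic M"
proof (rule atomicI)
  fix x assume "x \<in> M"
  show "factorizations M x \<noteq> {}"
  proof
    assume "factorizations M x = {}"
    hence "{x\<in>M. factorizations M x = {}} \<noteq> {}" using \<open>x \<in> M\<close> by blast
    then obtain w where w: "w \<in> M" "factorizations M w = {}"
      and min: "\<And>y z. y \<in> M \<Longrightarrow> factorizations M y = {} \<Longrightarrow> z \<in> M \<Longrightarrow> w = y + z \<Longrightarrow> z = 0"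
      using ACCP_minimal[OF assms, of "{x\<in>M. factorizations M x = {}}"] by blast
    have "{#} \<in> factorizations M 0" by (simp add: factorizations_def)
    hence "w \<noteq> 0" using w by force
    moreover have "{#a#} \<in> factorizations M a" if "a \<in> atoms M" for a
      using that by (simp add: factorizations_def)
    hence "w \<notin> atoms M" using w by blast
    ultimately obtain y z where yz: "y \<in> M" "z \<in> M" "w = y + z" "y \<noteq> 0" "z \<noteq> 0"
      using w(1) unfolding atoms_def by blast
    hence "factorizations M y \<noteq> {}" "factorizations M z \<noteq> {}"
      using min[of y z] min[of z y] by (auto simp: add.commute)
    thus False using factorizations_add[of _ M y _ z] w yz(3) by blast
  qed
qed (fact assms)

section \<open>From finite factorization to the ascending chain condition\<close>

lemma FFM_imp_BFM: "FFM M \<Longrightarrow> BFM M"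
  by (auto simp: FFM_def BFM_def factorization_lengths_def)

lemma BFM_imp_ACCP:
  assumes "add_submonoid M" "BFM M"
  shows "ACCP M"
  unfolding ACCP_def
proof (intro allI impI)
  fix I :: "nat \<Rightarrow> 'a set"
  assume "(\<forall>n. principal_ideal M (I n)) \<and> (\<forall>n. I n \<subseteq> I (Suc n))"
  hence I: "\<And>n. principal_ideal M (I n)" "\<And>n. I n \<subseteq> I (Suc n)" by auto
  obtain x where x: "\<And>n. x n \<in> M" "\<And>n. I n = (+) (x n) ` M"
    using I(1) unfolding principal_ideal_def by metis
  have atomic: "atomic M" and fin: "finite (factorization_lengths M y)" if "y \<in> M" for y
    using assms(2) that by (auto simp: BFM_def)
  define L where "L n = Max (factorization_lengths M (x n))" for n
  \<comment> \<open>A factorization of the difference \<open>d\<close>, added to a longest one of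
    \<open>x (Suc n)\<close>, factors \<open>x n\<close>. If the maxima agree, the one of
    \<open>d\<close> is empty, so d = 0.\<close>
  have L: "L (Suc n) \<le> L n \<and> (L (Suc n) = L n \<longrightarrow> I (Suc n) = I n)" for n
  proof -
    have "x n \<in> I n" using x assms(1) unfolding add_submonoid_def by force
    hence "x n \<in> I (Suc n)" using I by blast
    then obtain d where d: "d \<in> M" "x n = x (Suc n) + d" using x(2) by auto
    obtain D where D: "D \<in> factorizations M d"
      using factorization_exists atomic d by blast
    have "factorizations M (x (Suc n)) \<noteq> {}"
      using factorization_exists atomic x by blast
    hence "factorization_lengths M (x (Suc n)) \<noteq> {}" by (simp add: factorization_lengths_def)
    hence "L (Suc n) \<in> factorization_lengths M (x (Suc n))"
      unfolding L_def using fin x by (intro Max_in) auto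
    then obtain F where F: "F \<in> factorizations M (x (Suc n))" "size F = L (Suc n)"
      by (auto simp: factorization_lengths_def)
    have "size (F + D) \<in> factorization_lengths M (x n)"
      using factorizations_add[OF F(1) D] d by (simp add: factorization_lengths_def del: size_union)
    hence "size (F + D) \<le> L n" unfolding L_def using fin x by (intro Max_ge) auto
    hence le: "L (Suc n) + size D \<le> L n" using F by simp
    have "I (Suc n) = I n" if "D = {#}"
    proof -
      have "d = 0" using D that by (simp add: factorizations_def)
      thus ?thesis using d x(2) by simp
    qed
    thus ?thesis using le by fastforce
  qed
  obtain N where N: "\<And>n. L N \<le> L n"
    using ex_has_least_nat[of "\<lambda>_. True" 0 L] by blast
  have "I n = I N" if "n \<ge> N" for n
    using that
  proof (induction n rule: dec_induct)
    case (step n)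
    have "L n \<le> L N" using step(1) L by (induction n rule: dec_induct) (auto intro: order_trans)
    hence "L (Suc n) = L n" using L[of n] N[of "Suc n"] by linarith
    thus ?case using L[of n] step by simp
  qed simp
  thus "\<exists>N. \<forall>n\<ge>N. I n = I N" by blast
qed

subsection \<open>Polynomials with natural coefficients\<close>

text \<open>Natural coefficients are a predicate on real polynomials so that subtraction is not
  truncated and the positivity theorem applies directly.\<close>

definition nat_coeffs :: "real poly \<Rightarrow> bool" where
  "nat_coeffs p \<longleftrightarrow> (\<forall>i. coeff p i \<in> \<nat>)"

lemma nat_coeffs_add: "nat_coeffs p \<Longrightarrow> nat_coeffs q \<Longrightarrow> nat_coeffs (p + q)"
  by (simp add: nat_coeffs_def)

lemma sum_in_Nats: "(\<And>i. i \<in> A \<Longrightarrow> f i \<in> \<nat>) \<Longrightarrow> sum f A \<in> \<nat>"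
  by (induction A rule: infinite_finite_induct) auto

lemma nat_coeffs_mult: "nat_coeffs p \<Longrightarrow> nat_coeffs q \<Longrightarrow> nat_coeffs (p * q)"
  unfolding nat_coeffs_def coeff_mult by (intro allI sum_in_Nats Nats_mult) auto

lemma nat_coeffs_monom: "nat_coeffs (monom 1 n)"
  by (simp add: nat_coeffs_def)

lemma nat_poly_values_eq: "nat_poly_values \<alpha> = {poly p \<alpha> | p. nat_coeffs p}"
proof -
  have "\<exists>f :: nat poly. p = map_poly real f" if "nat_coeffs p" for p
  proof
    have "coeff p i = real (nat \<lfloor>coeff p i\<rfloor>)" for i
      using that unfolding nat_coeffs_def by (metis Nats_cases floor_of_nat nat_int of_nat_eq_iff)
    thus "p = map_poly real (map_poly (\<lambda>c. nat \<lfloor>c\<rfloor>) p)"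
      by (intro poly_eqI) (simp add: coeff_map_poly)
  qed
  moreover have "nat_coeffs (map_poly real f)" for f
    by (simp add: nat_coeffs_def coeff_map_poly)
  ultimately show ?thesis unfolding nat_poly_values_def by blast
qed

lemma nat_poly_valuesI: "nat_coeffs p \<Longrightarrow> poly p \<alpha> \<in> nat_poly_values \<alpha>"
  by (auto simp: nat_poly_values_eq)

lemma nat_poly_values_mult:
  assumes "x \<in> nat_poly_values \<alpha>" "y \<in> nat_poly_values \<alpha>"
  shows "x * y \<in> nat_poly_values \<alpha>"
proof -
  obtain p q where "nat_coeffs p" "nat_coeffs q" "x = poly p \<alpha>" "y = poly q \<alpha>"
    using assms by (auto simp: nat_poly_values_eq)
  thus ?thesis using nat_poly_valuesI[OF nat_coeffs_mult, of p q] by simp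
qed

lemma power_in_nat_poly_values: "\<alpha> ^ n \<in> nat_poly_values \<alpha>"
  using nat_poly_valuesI[OF nat_coeffs_monom, of n \<alpha>] by (simp add: poly_monom)

lemma reduced_nat_poly_values: "\<alpha> > 0 \<Longrightarrow> reduced (nat_poly_values \<alpha>)"
  using nat_poly_values_reduced unfolding reduced_def by blast

lemma ACCP_minimal_nat_poly_values:
  assumes "\<alpha> > 0" "ACCP (nat_poly_values \<alpha>)" "S \<subseteq> nat_poly_values \<alpha>" "S \<noteq> {}"
  obtains x where "x \<in> S" "\<And>y. y \<in> S \<Longrightarrow> x - y \<in> nat_poly_values \<alpha> \<Longrightarrow> y = x"
proof -
  obtain x where "x \<in> S"
    and min: "\<And>y z. y \<in> S \<Longrightarrow> z \<in> nat_poly_values \<alpha> \<Longrightarrow> x = y + z \<Longrightarrow> z = 0"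
    using ACCP_minimal[OF add_submonoid_nat_poly_values reduced_nat_poly_values assms(2-)] assms(1)
    by blast
  have "y = x" if "y \<in> S" "x - y \<in> nat_poly_values \<alpha>" for y
    using min[OF that] by simp
  thus thesis using that \<open>x \<in> S\<close> by blast
qed

lemma nat_coeffs_diff_monom:
  assumes "nat_coeffs p" "coeff p i \<noteq> 0"
  shows "nat_coeffs (p - monom 1 i)"
  unfolding nat_coeffs_def
proof
  fix j
  obtain m where m: "coeff p i = of_nat m"
    using assms unfolding nat_coeffs_def by (meson Nats_cases)
  hence "coeff p i - 1 = of_nat (m - 1)" using assms(2) by (cases m) auto
  thus "coeff (p - monom 1 i) j \<in> \<nat>"
    using assms(1) by (auto simp: nat_coeffs_def)
qed

lemma poly_nonneg_nat_coeffs: "nat_coeffs p \<Longrightarrow> x \<ge> 0 \<Longrightarrow> poly p x \<ge> 0"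
  unfolding nat_coeffs_def poly_altdef by (intro sum_nonneg mult_nonneg_nonneg) (auto simp: Nats_altdef2)

lemma poly_pos_nat_coeffs:
  assumes "nat_coeffs p" "p \<noteq> 0" "x > 0"
  shows "poly p x > 0"
proof -
  obtain i where "coeff p i \<noteq> 0" using assms(2) by (metis leading_coeff_0_iff)
  hence "nat_coeffs (p - monom 1 i)" using assms nat_coeffs_diff_monom by blast
  hence "poly (p - monom 1 i) x \<ge> 0" by (rule poly_nonneg_nat_coeffs) (use assms(3) in simp)
  hence "poly p x \<ge> x ^ i" by (simp add: poly_monom)
  thus ?thesis using zero_less_power[OF assms(3), of i] by linarith
qed

lemma nat_coeffs_power: "nat_coeffs p \<Longrightarrow> nat_coeffs (p ^ n)"
proof (induction n)
  case 0
  show ?case by (simp add: nat_coeffs_def)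
qed (simp add: nat_coeffs_mult)

lemma poly_mono_nat_coeffs:
  assumes "nat_coeffs p" "0 \<le> x" "x \<le> y"
  shows "poly p x \<le> poly p y"
  using assms unfolding nat_coeffs_def poly_altdef
  by (intro sum_mono mult_left_mono power_mono) (auto simp: Nats_altdef2)

text \<open>Passing from x to y multiplies the i-th monomial by (y/x)^i, and y/x is at least
  1.\<close>

lemma poly_le_degree_scaling:
  assumes "nat_coeffs p" "0 < x" "x \<le> y"
  shows "poly p y \<le> poly p x * (y / x) ^ degree p"
proof -
  have "coeff p i * y ^ i \<le> coeff p i * x ^ i * (y / x) ^ degree p" if "i \<le> degree p" for i
  proof -
    have "y ^ i = x ^ i * (y / x) ^ i" using assms by (simp add: power_divide)
    also have "\<dots> \<le> x ^ i * (y / x) ^ degree p"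
      using assms that by (intro mult_left_mono power_increasing) auto
    finally show ?thesis
      using assms(1) unfolding mult.assoc nat_coeffs_def
      by (intro mult_left_mono) (auto simp: Nats_altdef2)
  qed
  thus ?thesis unfolding poly_altdef sum_distrib_right by (intro sum_mono) auto
qed

subsection \<open>Representations and factorizations\<close>

text \<open>
  Two representations \<open>b\<close> and \<open>X^n h\<close> of the same element give
  \<open>q = X^n h + b - 2 X^k b\<close>, whose value at \<open>\<alpha>\<close> is \<open>2 (1 - \<alpha>^k) b(\<alpha>)\<close>. It is positive on the
  positive reals: for \<open>x \<le> \<alpha>\<close> because \<open>2 x^k \<le> 1\<close>, for \<open>x > \<alpha>\<close> because \<open>X^n h\<close> grows faster
  than \<open>X^k b\<close>. Hence some \<open>(1 + X)^N q\<close> has coefficients in \<open>\<nat>\<close>.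
\<close>
lemma two_representations_descent:
  fixes \<alpha> :: real
  assumes "\<alpha> > 0" "nat_coeffs b" "b \<noteq> 0" "nat_coeffs h"
    and k: "\<alpha> ^ k \<le> 1 / 2" and n: "degree b + k \<le> n"
    and eq: "poly b \<alpha> = \<alpha> ^ n * poly h \<alpha>"
  obtains t where "t \<in> nat_poly_values \<alpha>" "t > 0" "t - t * \<alpha> ^ k \<in> nat_poly_values \<alpha>"
proof -
  define q where "q = monom 1 n * h + b - smult 2 (monom 1 k * b)"
  have q: "poly q x = x ^ n * poly h x + poly b x - 2 * x ^ k * poly b x" for x
    by (simp add: q_def poly_monom)
  have b_pos: "poly b x > 0" if "x > 0" for x
    using that assms poly_pos_nat_coeffs by blast
  have "h \<noteq> 0" using eq b_pos[OF assms(1)] by auto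
  have "poly q x > 0" if x: "x > 0" for x
  proof (cases "x \<le> \<alpha>")
    case True
    have "x ^ k \<le> 1 / 2" using True x k power_mono[of x \<alpha> k] by simp
    hence "x ^ k * poly b x \<le> 1 / 2 * poly b x" using b_pos[OF x] by (intro mult_right_mono) auto
    moreover have "x ^ n * poly h x > 0"
      using x poly_pos_nat_coeffs[OF assms(4) \<open>h \<noteq> 0\<close>] by simp
    ultimately show ?thesis unfolding q by simp
  next
    case False
    \<comment> \<open>The factor 2 is traded for \<alpha>^(-k). From \<alpha> to x, \<open>b\<close>
      grows at most by the power \<open>degree b\<close> of x/\<alpha>, so n \<ge> degree b + k lets
      X^n h absorb all of it.\<close>
    have "2 \<le> 1 / \<alpha> ^ k" using k assms(1) by (simp add: field_simps)
    hence "2 * (x ^ k * poly b x) \<le> 1 / \<alpha> ^ k * (x ^ k * poly b x)"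
      using x b_pos[OF x] by (intro mult_right_mono) auto
    also have "\<dots> = (x / \<alpha>) ^ k * poly b x" by (simp add: power_divide)
    also have "\<dots> \<le> (x / \<alpha>) ^ k * (poly b \<alpha> * (x / \<alpha>) ^ degree b)"
      using False assms x by (intro mult_left_mono poly_le_degree_scaling) auto
    also have "\<dots> = poly b \<alpha> * (x / \<alpha>) ^ (degree b + k)" by (simp add: power_add)
    also have "\<dots> \<le> poly b \<alpha> * (x / \<alpha>) ^ n"
      using False assms b_pos[OF assms(1)] by (intro mult_left_mono power_increasing) auto
    also have "\<dots> = x ^ n * poly h \<alpha>" using assms(1) by (simp add: eq power_divide)
    also have "\<dots> \<le> x ^ n * poly h x"
      using False assms x by (intro mult_left_mono poly_mono_nat_coeffs) auto
    finally show ?thesis unfolding q using b_pos[OF x] by simp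
  qed
  then obtain N where N: "nonneg_coeffs ([:1, 1:] ^ N * q)"
    using positive_poly_nonneg_coeffs_multiple by blast
  have X1: "nat_coeffs ([:1, 1:] ^ N)"
    by (rule nat_coeffs_power) (auto simp: nat_coeffs_def coeff_pCons split: nat.split)
  \<comment> \<open>Integrality upgrades the nonnegative coefficients of (1 + X)^N q to natural
    ones.\<close>
  have "coeff q i \<in> \<int>" for i
    using nat_coeffs_add[OF nat_coeffs_mult[OF nat_coeffs_monom assms(4)] assms(2), of n]
      nat_coeffs_mult[OF nat_coeffs_monom assms(2), of k]
    unfolding q_def nat_coeffs_def coeff_diff coeff_smult
    by (intro Ints_diff Ints_mult) (auto simp: Nats_altdef2)
  hence "coeff ([:1, 1:] ^ N * q) i \<in> \<int>" for i
    using X1 unfolding coeff_mult nat_coeffs_def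
    by (intro Ints_sum Ints_mult) (auto simp: Nats_altdef2)
  hence nat: "nat_coeffs ([:1, 1:] ^ N * q)"
    using N by (simp add: nat_coeffs_def nonneg_coeffs_def Nats_altdef2)
  \<comment> \<open>The summand b + b matches q(\<alpha>) = 2 b(\<alpha>) (1 - \<alpha>^k).\<close>
  define t where "t = poly ([:1, 1:] ^ N * (b + b)) \<alpha>"
  show thesis
  proof
    show "t \<in> nat_poly_values \<alpha>"
      unfolding t_def using assms X1 by (intro nat_poly_valuesI nat_coeffs_mult nat_coeffs_add)
    show "t > 0" using b_pos[OF assms(1)] assms(1) by (simp add: t_def poly_power)
    have "poly q \<alpha> = poly (b + b) \<alpha> * (1 - \<alpha> ^ k)"
      unfolding q eq[symmetric] by (simp add: algebra_simps)
    hence "t - t * \<alpha> ^ k = poly ([:1, 1:] ^ N * q) \<alpha>"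
      by (simp only: t_def poly_mult) (simp add: algebra_simps)
    thus "t - t * \<alpha> ^ k \<in> nat_poly_values \<alpha>" using nat_poly_valuesI[OF nat] by simp
  qed
qed

text \<open>Multiplying the given difference by \<alpha>^(ki) shows that each t \<alpha>^(k(i+1))
  properly divides t \<alpha>^(ki), so these elements have no minimal one.\<close>

lemma not_ACCP_if_descent:
  assumes "\<alpha> > 0" "t \<in> nat_poly_values \<alpha>" "t > 0"
    and "t - t * \<alpha> ^ k \<in> nat_poly_values \<alpha>" "\<alpha> ^ k < 1"
  shows "\<not> ACCP (nat_poly_values \<alpha>)"
proof
  assume "ACCP (nat_poly_values \<alpha>)"
  moreover have "range (\<lambda>i. t * \<alpha> ^ (k * i)) \<subseteq> nat_poly_values \<alpha>"
    using assms nat_poly_values_mult power_in_nat_poly_values by blast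
  ultimately obtain x where "x \<in> range (\<lambda>i. t * \<alpha> ^ (k * i))"
    and min: "\<And>y. y \<in> range (\<lambda>i. t * \<alpha> ^ (k * i)) \<Longrightarrow> x - y \<in> nat_poly_values \<alpha> \<Longrightarrow> y = x"
    using ACCP_minimal_nat_poly_values[OF assms(1), of "range (\<lambda>i. t * \<alpha> ^ (k * i))"] by blast
  then obtain i where i: "x = t * \<alpha> ^ (k * i)" by blast
  have "x - t * \<alpha> ^ (k * Suc i) = \<alpha> ^ (k * i) * (t - t * \<alpha> ^ k)"
    by (simp add: i power_add algebra_simps)
  hence "x - t * \<alpha> ^ (k * Suc i) \<in> nat_poly_values \<alpha>"
    using assms nat_poly_values_mult power_in_nat_poly_values by metis
  hence "t * \<alpha> ^ (k * Suc i) = x" using min by blast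
  hence "\<alpha> ^ k = 1" using assms by (simp add: i power_add)
  thus False using assms by simp
qed

text \<open>These are formal sums of powers of \<alpha>, indexed by exponents; the powers need not
  be atoms.\<close>

definition representations :: "real \<Rightarrow> real \<Rightarrow> real poly set" where
  "representations \<alpha> x = {p. nat_coeffs p \<and> poly p \<alpha> = x}"

lemma finite_representations:
  assumes "0 < \<alpha>" "\<alpha> < 1" "ACCP (nat_poly_values \<alpha>)"
  shows "finite (representations \<alpha> x)"
proof (rule ccontr)
  define S where "S = {x. infinite (representations \<alpha> x)}"
  assume "infinite (representations \<alpha> x)"
  hence "S \<noteq> {}" by (auto simp: S_def)
  moreover have "S \<subseteq> nat_poly_values \<alpha>"
  proof
    fix y assume "y \<in> S"
    hence "representations \<alpha> y \<noteq> {}" unfolding S_def by auto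
    thus "y \<in> nat_poly_values \<alpha>" by (auto simp: representations_def nat_poly_values_eq)
  qed
  ultimately obtain w where w: "w \<in> S"
    and min: "\<And>y. y \<in> S \<Longrightarrow> w - y \<in> nat_poly_values \<alpha> \<Longrightarrow> y = w"
    using ACCP_minimal_nat_poly_values[OF assms(1,3)] by blast
  \<comment> \<open>Otherwise \<open>w - \<alpha>^i\<close> would be a smaller element with infinitely many representations.\<close>
  have fin: "finite {p \<in> representations \<alpha> w. coeff p i \<noteq> 0}" for i
  proof (rule ccontr)
    let ?P = "{p \<in> representations \<alpha> w. coeff p i \<noteq> 0}"
    assume inf: "infinite ?P"
    have "inj_on (\<lambda>p. p - monom 1 i) ?P" by (rule inj_onI) simp
    moreover have "(\<lambda>p. p - monom 1 i) ` ?P \<subseteq> representations \<alpha> (w - \<alpha> ^ i)"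
      using nat_coeffs_diff_monom by (auto simp: representations_def poly_monom)
    ultimately have "w - \<alpha> ^ i \<in> S"
      using inf finite_subset finite_imageD unfolding S_def by blast
    hence "w - \<alpha> ^ i = w" using min power_in_nat_poly_values by simp
    thus False using assms(1) by simp
  qed
  \<comment> \<open>Discarding the finitely many representations that involve some X^i with i < n
    leaves infinitely many.\<close>
  have high: "\<exists>p \<in> representations \<alpha> w. \<forall>i<n. coeff p i = 0" for n
  proof -
    have "finite (\<Union>i<n. {p \<in> representations \<alpha> w. coeff p i \<noteq> 0})" using fin by blast
    hence "infinite (representations \<alpha> w - (\<Union>i<n. {p \<in> representations \<alpha> w. coeff p i \<noteq> 0}))"
      using w by (simp add: S_def)
    hence "representations \<alpha> w - (\<Union>i<n. {p \<in> representations \<alpha> w. coeff p i \<noteq> 0}) \<noteq> {}"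
      by (metis finite.emptyI)
    thus ?thesis by blast
  qed
  have "infinite (representations \<alpha> w - {0})" using w by (simp add: S_def)
  hence "representations \<alpha> w - {0} \<noteq> {}" by (metis finite.emptyI)
  then obtain b where b: "nat_coeffs b" "poly b \<alpha> = w" "b \<noteq> 0"
    by (auto simp: representations_def)
  obtain k where k: "\<alpha> ^ k < 1 / 2" using real_arch_pow_inv[of "1 / 2" \<alpha>] assms by auto
  define n where "n = degree b + k"
  obtain p where p: "p \<in> representations \<alpha> w" "\<forall>i<n. coeff p i = 0" using high by blast
  then obtain h where h: "p = monom 1 n * h" by (metis monom_1_dvd_iff' dvdE)
  have "coeff h i = coeff p (i + n)" for i by (simp add: h coeff_monom_mult)
  hence "nat_coeffs h" using p by (simp add: representations_def nat_coeffs_def)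
  moreover have "poly b \<alpha> = \<alpha> ^ n * poly h \<alpha>"
    using p b by (simp add: representations_def h poly_monom)
  ultimately obtain t where "t \<in> nat_poly_values \<alpha>" "t > 0" "t - t * \<alpha> ^ k \<in> nat_poly_values \<alpha>"
    using two_representations_descent[of \<alpha> b h k n] assms b k by (auto simp: n_def)
  thus False using not_ACCP_if_descent[of \<alpha> t k] assms k by simp
qed

section \<open>From representations to factorizations\<close>

lemma atom_is_power:
  assumes "\<alpha> > 0" "a \<in> atoms (nat_poly_values \<alpha>)"
  shows "\<exists>i. a = \<alpha> ^ i"
proof -
  have "a \<in> nat_poly_values \<alpha>" "a \<noteq> 0" using assms(2) by (auto simp: atoms_def)
  then obtain p where p: "nat_coeffs p" "a = poly p \<alpha>"
    by (auto simp: nat_poly_values_eq)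
  moreover from this have "p \<noteq> 0" using \<open>a \<noteq> 0\<close> by auto
  ultimately obtain i where "coeff p i \<noteq> 0" by (metis leading_coeff_0_iff)
  hence "poly (p - monom 1 i) \<alpha> \<in> nat_poly_values \<alpha>"
    using p nat_coeffs_diff_monom nat_poly_valuesI by blast
  moreover have eq: "a = \<alpha> ^ i + poly (p - monom 1 i) \<alpha>" using p by (simp add: poly_monom)
  \<comment> \<open>An atom cannot split properly, and \<alpha>^i is nonzero, so the rest of the sum
    vanishes.\<close>
  ultimately have "\<alpha> ^ i = 0 \<or> poly (p - monom 1 i) \<alpha> = 0"
    using assms(2) power_in_nat_poly_values unfolding atoms_def by blast
  hence "a = \<alpha> ^ i" using eq assms(1) by simp
  thus ?thesis by blast
qed

text \<open>Choosing an exponent for each atom turns a factorization into a representation. This is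
  injective, since the coefficients count the exponents and each exponent determines its
  atom.\<close>

lemma finite_factorizations_if_finite_representations:
  assumes "\<alpha> > 0" "finite (representations \<alpha> x)"
  shows "finite (factorizations (nat_poly_values \<alpha>) x)"
proof -
  obtain e where e: "\<And>a. a \<in> atoms (nat_poly_values \<alpha>) \<Longrightarrow> \<alpha> ^ e a = a"
    using atom_is_power[OF assms(1)] by metis
  define g where "g F = (\<Sum>a\<in>#F. monom (1::real) (e a))" for F
  have g: "coeff (g F) i = real (count (image_mset e F) i)" for F i
    by (induction F) (auto simp: g_def)
  have powers: "image_mset (\<lambda>i. \<alpha> ^ i) (image_mset e F) = F"
    if "set_mset F \<subseteq> atoms (nat_poly_values \<alpha>)" for F
  proof -
    have "image_mset (\<lambda>a. \<alpha> ^ e a) F = image_mset (\<lambda>a. a) F"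
      using that e by (intro image_mset_cong) auto
    thus ?thesis by (simp only: multiset.map_comp comp_def multiset.map_ident)
  qed
  have "inj_on g (factorizations (nat_poly_values \<alpha>) x)"
  proof (rule inj_onI)
    fix F G
    assume F: "F \<in> factorizations (nat_poly_values \<alpha>) x"
      and G: "G \<in> factorizations (nat_poly_values \<alpha>) x" and "g F = g G"
    hence "real (count (image_mset e F) i) = real (count (image_mset e G) i)" for i
      by (metis g)
    hence "image_mset e F = image_mset e G" by (intro multiset_eqI) simp
    moreover have "set_mset F \<subseteq> atoms (nat_poly_values \<alpha>)" "set_mset G \<subseteq> atoms (nat_poly_values \<alpha>)"
      using F G by (simp_all add: factorizations_def)
    ultimately show "F = G" using powers by metis
  qed
  moreover have "g F \<in> representations \<alpha> x" if "F \<in> factorizations (nat_poly_values \<alpha>) x" for F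
  proof -
    have "poly (g F) \<alpha> = \<Sum>\<^sub># (image_mset (\<lambda>i. \<alpha> ^ i) (image_mset e F))"
      by (induction F) (auto simp: g_def poly_monom)
    moreover have "\<dots> = x" using that by (simp only: factorizations_def mem_Collect_eq powers)
    ultimately show ?thesis by (simp add: representations_def nat_coeffs_def g)
  qed
  ultimately show ?thesis using assms(2) by (meson finite_imageD finite_subset image_subsetI)
qed

text \<open>All atoms are at least 1, so a factorization of x has length at most x and uses only the
  finitely many atoms up to x.\<close>

lemma finite_factorizations_ge_1:
  assumes "\<alpha> \<ge> 1"
  shows "finite (factorizations (nat_poly_values \<alpha>) x)"
proof -
  define A where "A = {a \<in> atoms (nat_poly_values \<alpha>). a \<le> x}"
  have ge1: "a \<ge> 1" if "a \<in> atoms (nat_poly_values \<alpha>)" for a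
    using atom_is_power[OF _ that] assms one_le_power by force
  have "finite A"
  \<comment> \<open>Powers of \<alpha> outgrow x only for \<alpha> > 1; for \<alpha> = 1 the only
    possible atom is 1.\<close>
  proof (cases "\<alpha> = 1")
    case True
    hence "A \<subseteq> {1}" using atom_is_power[of \<alpha>] by (auto simp: A_def)
    thus ?thesis using finite_subset by blast
  next
    case False
    then obtain n where n: "x < \<alpha> ^ n" using real_arch_pow[of \<alpha> x] assms by auto
    have "A \<subseteq> (\<lambda>i. \<alpha> ^ i) ` {..<n}"
    proof
      fix a assume a: "a \<in> A"
      then obtain i where i: "a = \<alpha> ^ i" using atom_is_power[of \<alpha>] assms by (auto simp: A_def)
      hence "\<alpha> ^ i < \<alpha> ^ n" using a n by (simp add: A_def)
      hence "i < n" using assms False by (simp add: power_strict_increasing_iff)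
      thus "a \<in> (\<lambda>i. \<alpha> ^ i) ` {..<n}" using i by blast
    qed
    thus ?thesis using finite_subset by blast
  qed
  have size: "real (size F) \<le> \<Sum>\<^sub># F" if "set_mset F \<subseteq> atoms (nat_poly_values \<alpha>)" for F
    using that by (induction F) (use ge1 in force)+
  have "F \<in> (\<Union>n\<le>nat \<lfloor>x\<rfloor>. multisets_of_size A n)"
    if F: "F \<in> factorizations (nat_poly_values \<alpha>) x" for F
  proof -
    have at: "set_mset F \<subseteq> atoms (nat_poly_values \<alpha>)" and sum: "\<Sum>\<^sub># F = x"
      using F by (auto simp: factorizations_def)
    have "a \<le> x" if "a \<in># F" for a
    proof -
      obtain G where G: "F = add_mset a G" using \<open>a \<in># F\<close> by (meson multi_member_split)
      have "real (size G) \<le> \<Sum>\<^sub># G" using size at G by simp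
      thus ?thesis using sum G by simp
    qed
    hence "set_mset F \<subseteq> A" using at by (auto simp: A_def)
    moreover have "size F \<le> nat \<lfloor>x\<rfloor>" using size[OF at] sum by (simp add: le_nat_floor)
    ultimately show ?thesis by (auto simp: multisets_of_size_def)
  qed
  moreover have "finite (\<Union>n\<le>nat \<lfloor>x\<rfloor>. multisets_of_size A n)"
    using \<open>finite A\<close> by blast
  ultimately show ?thesis by (meson finite_subset subsetI)
qed

lemma ACCP_imp_FFM:
  assumes "\<alpha> > 0" "ACCP (nat_poly_values \<alpha>)"
  shows "FFM (nat_poly_values \<alpha>)"
proof -
  have "finite (factorizations (nat_poly_values \<alpha>) x)" for x
  proof (cases "\<alpha> < 1")
    case True
    thus ?thesis
      using assms finite_representations finite_factorizations_if_finite_representations by blast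
  next
    case False
    thus ?thesis using finite_factorizations_ge_1 by simp
  qed
  thus ?thesis
    using ACCP_imp_atomic[OF add_submonoid_nat_poly_values reduced_nat_poly_values] assms
    by (simp add: FFM_def)
qed

theorem theorem4p11:
  fixes \<alpha> :: real
  assumes "\<alpha> > 0"
  shows "(FFM (nat_poly_values \<alpha>) \<longleftrightarrow> BFM (nat_poly_values \<alpha>)) \<and>
         (BFM (nat_poly_values \<alpha>) \<longleftrightarrow> ACCP (nat_poly_values \<alpha>))"
  using FFM_imp_BFM BFM_imp_ACCP[OF add_submonoid_nat_poly_values] ACCP_imp_FFM[OF assms]
  by blast

end
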